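(* Let $n\ge 1$ and let $\mathcal{E}_n$ be the Fomin–Kirillov quadratic algebra. For $p\in\{1,\ldots,n\}$ define the $K$-theoretic Dunkl element \[\kappa_p:=1-(1+[p-1,p])(1+[p-2,p])\cdots(1+[1p])(1+[np])(1+[n-1,p])\cdots(1+[p+1,p])\in\mathcal{E}_n.\] Then $\kappa_p\kappa_q=\kappa_q\kappa_p$ in $\mathcal{E}_n$ for all $p,q\in\{1,\ldots,n\}$.
   Context: The quadratic algebra $\mathcal{E}_n$ is the associative algebra (over $\mathbb{Z}$, with unit $1$) with generators $[ij]$ for $1\le i\ne j\le n$, subject to the relations: (i) $[ij]+[ji]=0$; (ii) $[ij]^2=0$; (iii) $[ij][jk]+[jk][ki]+[ki][ij]=0$; (iv) $[ij][kl]=[kl][ij]$, for all pairwise distinct $i,j,k,l$. In the definition of $\kappa_p$ the product runs over all $i\neq p$, in the order $i=p-1,p-2,\ldots,1,n,n-1,\ldots,p+1$. *)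

theory Defs
  imports "HOL-Library.Poly_Mapping" "HOL-Algebra.QuotRing"
begin

text \<open>
  The free monoid on a set of letters, written additively: with this class instance the
  convolution product on finitely supported maps from words to integers is the
  (noncommutative) product of the free associative ring.
\<close>

datatype 'a fword = FWord (letters: "'a list")

instantiation fword :: (type) monoid_add
begin

definition zero_fword :: "'a fword" where
  "0 = FWord []"

definition plus_fword :: "'a fword \<Rightarrow> 'a fword \<Rightarrow> 'a fword" where
  "u + v = FWord (letters u @ letters v)"

instance
  by standard (simp_all add: zero_fword_def plus_fword_def)

end

definition free_ring :: "'a set \<Rightarrow> ('a fword \<Rightarrow>\<^sub>0 int) ring" where
  "free_ring X =
    \<lparr>carrier = {f. \<forall>w \<in> Poly_Mapping.keys f. set (letters w) \<subseteq> X},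
     mult = (*), one = 1, zero = 0, add = (+)\<rparr>"

definition free_gen :: "'a \<Rightarrow> ('a fword \<Rightarrow>\<^sub>0 int)" where
  "free_gen x = Poly_Mapping.single (FWord [x]) 1"

lemma free_ring_simps [simp]:
  "mult (free_ring X) = (*)" "one (free_ring X) = 1"
  "zero (free_ring X) = 0" "add (free_ring X) = (+)"
  by (simp_all add: free_ring_def)

lemma free_ring_carrier_iff:
  "f \<in> carrier (free_ring X) \<longleftrightarrow> (\<forall>w \<in> Poly_Mapping.keys f. set (letters w) \<subseteq> X)"
  by (simp add: free_ring_def)

lemma free_ring_closed:
  shows free_ring_zero_closed: "0 \<in> carrier (free_ring X)"
    and free_ring_one_closed: "1 \<in> carrier (free_ring X)"
    and free_ring_add_closed:
      "f \<in> carrier (free_ring X) \<Longrightarrow> g \<in> carrier (free_ring X) \<Longrightarrow> f + g \<in> carrier (free_ring X)"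
    and free_ring_diff_closed:
      "f \<in> carrier (free_ring X) \<Longrightarrow> g \<in> carrier (free_ring X) \<Longrightarrow> f - g \<in> carrier (free_ring X)"
    and free_ring_uminus_closed:
      "f \<in> carrier (free_ring X) \<Longrightarrow> - f \<in> carrier (free_ring X)"
    and free_ring_mult_closed:
      "f \<in> carrier (free_ring X) \<Longrightarrow> g \<in> carrier (free_ring X) \<Longrightarrow> f * g \<in> carrier (free_ring X)"
  using keys_add[of f g] keys_diff[of f g] keys_mult[of f g]
  by (fastforce simp: free_ring_carrier_iff zero_fword_def plus_fword_def)+

lemma free_gen_closed: "x \<in> X \<Longrightarrow> free_gen x \<in> carrier (free_ring X)"
  by (simp add: free_ring_carrier_iff free_gen_def)

lemma ring_free_ring: "ring (free_ring X)"
proof (rule ringI)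
  show "abelian_group (free_ring X)"
  proof (rule abelian_groupI)
    fix f assume "f \<in> carrier (free_ring X)"
    then show "\<exists>g \<in> carrier (free_ring X). g \<oplus>\<^bsub>free_ring X\<^esub> f = \<zero>\<^bsub>free_ring X\<^esub>"
      by (intro bexI[of _ "- f"]) (simp_all add: free_ring_uminus_closed)
  qed (simp_all add: free_ring_closed algebra_simps)
  show "monoid (free_ring X)"
    by (rule monoidI) (simp_all add: free_ring_closed algebra_simps)
qed (simp_all add: algebra_simps)

definition FK_gens :: "nat \<Rightarrow> (nat \<times> nat) set" where
  "FK_gens n = {(i, j). i \<in> {1..n} \<and> j \<in> {1..n} \<and> i \<noteq> j}"

abbreviation FK_free :: "nat \<Rightarrow> ((nat \<times> nat) fword \<Rightarrow>\<^sub>0 int) ring" where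
  "FK_free n \<equiv> free_ring (FK_gens n)"

text \<open>Each relation \<open>u = v\<close> is recorded as the element \<open>u - v\<close> of the free ring.\<close>

definition FK_rels :: "nat \<Rightarrow> ((nat \<times> nat) fword \<Rightarrow>\<^sub>0 int) set" where
  "FK_rels n =
    {free_gen (i, j) + free_gen (j, i) | i j.
       {i, j} \<subseteq> {1..n} \<and> distinct [i, j]} \<union>
    {free_gen (i, j) * free_gen (i, j) | i j.
       {i, j} \<subseteq> {1..n} \<and> distinct [i, j]} \<union>
    {free_gen (i, j) * free_gen (j, k) + free_gen (j, k) * free_gen (k, i)
       + free_gen (k, i) * free_gen (i, j) | i j k.
       {i, j, k} \<subseteq> {1..n} \<and> distinct [i, j, k]} \<union>
    {free_gen (i, j) * free_gen (k, l) - free_gen (k, l) * free_gen (i, j) | i j k l.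
       {i, j, k, l} \<subseteq> {1..n} \<and> distinct [i, j, k, l]}"

definition FK_ideal :: "nat \<Rightarrow> ((nat \<times> nat) fword \<Rightarrow>\<^sub>0 int) set" where
  "FK_ideal n = Idl\<^bsub>FK_free n\<^esub> (FK_rels n)"

definition FK_alg :: "nat \<Rightarrow> ((nat \<times> nat) fword \<Rightarrow>\<^sub>0 int) set ring" where
  "FK_alg n = FK_free n Quot FK_ideal n"

text \<open>The class of the generator \<open>[ij]\<close>; meaningful only for distinct \<open>i\<close>, \<open>j\<close> in \<open>{1..n}\<close>.\<close>

definition FK_gen :: "nat \<Rightarrow> nat \<Rightarrow> nat \<Rightarrow> ((nat \<times> nat) fword \<Rightarrow>\<^sub>0 int) set" where
  "FK_gen n i j = FK_ideal n +>\<^bsub>FK_free n\<^esub> free_gen (i, j)"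

text \<open>The list of indices is \<open>p - 1, \<dots>, 1, n, n - 1, \<dots>, p + 1\<close>.\<close>

definition dunkl_K :: "nat \<Rightarrow> nat \<Rightarrow> ((nat \<times> nat) fword \<Rightarrow>\<^sub>0 int) set" where
  "dunkl_K n p =
    \<one>\<^bsub>FK_alg n\<^esub> \<ominus>\<^bsub>FK_alg n\<^esub>
      foldr (\<lambda>i x. (\<one>\<^bsub>FK_alg n\<^esub> \<oplus>\<^bsub>FK_alg n\<^esub> FK_gen n i p) \<otimes>\<^bsub>FK_alg n\<^esub> x)
        (rev [1..<p] @ rev [Suc p..<Suc n]) \<one>\<^bsub>FK_alg n\<^esub>"

lemma FK_rels_subset: "FK_rels n \<subseteq> carrier (FK_free n)"
  unfolding FK_rels_def
  by (auto intro!: free_ring_closed free_gen_closed simp: FK_gens_def)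

lemma ideal_FK_ideal: "ideal (FK_ideal n) (FK_free n)"
  unfolding FK_ideal_def
  by (rule ring.genideal_ideal[OF ring_free_ring FK_rels_subset])

lemma ring_FK_alg: "ring (FK_alg n)"
  unfolding FK_alg_def by (rule ideal.quotient_is_ring[OF ideal_FK_ideal])

lemma FK_gen_closed:
  assumes "i \<in> {1..n}" "j \<in> {1..n}" "i \<noteq> j"
  shows "FK_gen n i j \<in> carrier (FK_alg n)"
proof -
  have "free_gen (i, j) \<in> carrier (FK_free n)"
    using assms by (intro free_gen_closed) (simp add: FK_gens_def)
  then show ?thesis
    unfolding FK_gen_def FK_alg_def FactRing_def A_RCOSETS_defs a_r_coset_def by auto
qed

end

theory Submission
  imports Defs
begin

text \<open>
  The elements \<open>R i j = 1 + [ij]\<close> are unitary (\<open>R i j R j i = 1\<close>) and satisfy the Yang--Baxter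
  equation, and \<open>R i j\<close> commutes with \<open>R k l\<close> for disjoint index pairs. Let \<open>p < q\<close>, and split the
  remaining indices, in cyclically descending order, into the arc \<open>A\<close> from \<open>p\<close> down to \<open>q\<close> (through
  \<open>1\<close> and \<open>n\<close>) and the arc \<open>B\<close> from \<open>q\<close> down to \<open>p\<close>. With \<open>R X j\<close> the ordered product of \<open>R x j\<close>
  over \<open>x\<close> in \<open>X\<close>, the products in question are \<open>R A p R q p R B p\<close> and \<open>R B q R p q R A q\<close>.
  Yang--Baxter moves \<open>R q p\<close> through \<open>R B p R B q\<close>, after which it cancels against \<open>R p q\<close>, and
  both orders of multiplication become \<open>R B q R A p R A q R B p\<close>.
\<close>

section \<open>Ordered products of a unitary Yang--Baxter family in a monoid\<close>

locale yang_baxter_family = monoid G for G (structure) +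
  fixes I :: "'i set" and R :: "'i \<Rightarrow> 'i \<Rightarrow> 'a"
  assumes R_closed: "\<lbrakk>i \<in> I; j \<in> I; i \<noteq> j\<rbrakk> \<Longrightarrow> R i j \<in> carrier G"
    and R_unitary: "\<lbrakk>i \<in> I; j \<in> I; i \<noteq> j\<rbrakk> \<Longrightarrow> R i j \<otimes> R j i = \<one>"
    and R_commute: "\<lbrakk>{i, j, k, l} \<subseteq> I; distinct [i, j, k, l]\<rbrakk> \<Longrightarrow> R i j \<otimes> R k l = R k l \<otimes> R i j"
    and yang_baxter: "\<lbrakk>{i, j, k} \<subseteq> I; distinct [i, j, k]\<rbrakk> \<Longrightarrow>
      R i j \<otimes> (R i k \<otimes> R j k) = R j k \<otimes> (R i k \<otimes> R i j)"
begin

text \<open>The right fold has the same shape as the one in \<open>dunkl_K\<close>, so the two match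
  by unfolding.\<close>

definition row :: "'i \<Rightarrow> 'i list \<Rightarrow> 'a" where
  "row p xs = foldr (\<lambda>i x. R i p \<otimes> x) xs \<one>"

lemma row_Nil [simp]: "row p [] = \<one>"
  and row_Cons [simp]: "row p (x # xs) = R x p \<otimes> row p xs"
  by (simp_all add: row_def)

lemma row_closed:
  "\<lbrakk>p \<in> I; set xs \<subseteq> I; p \<notin> set xs\<rbrakk> \<Longrightarrow> row p xs \<in> carrier G"
  by (induction xs) (auto intro: R_closed)

lemma row_append:
  "\<lbrakk>p \<in> I; set (xs @ ys) \<subseteq> I; p \<notin> set (xs @ ys)\<rbrakk> \<Longrightarrow> row p (xs @ ys) = row p xs \<otimes> row p ys"
  by (induction xs) (auto simp: row_closed R_closed m_assoc)

text \<open>Products below are mostly bracketed to the right, so a commutation has to be applied in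
  front of a tail \<open>z\<close>.\<close>

lemma mult_left_commute:
  "\<lbrakk>x \<otimes> y = y \<otimes> x; x \<in> carrier G; y \<in> carrier G; z \<in> carrier G\<rbrakk> \<Longrightarrow> x \<otimes> (y \<otimes> z) = y \<otimes> (x \<otimes> z)"
  by (simp flip: m_assoc)

lemma R_row_commute:
  assumes "p \<in> I" "q \<in> I" "p \<noteq> q" "x \<in> I" "set ys \<subseteq> I" "p \<notin> set ys" "q \<notin> set ys"
    and "x \<noteq> p" "x \<noteq> q" "x \<notin> set ys"
  shows "R x p \<otimes> row q ys = row q ys \<otimes> R x p"
  using assms
proof (induction ys)
  case Nil
  then show ?case by (simp add: R_closed)
next
  case (Cons y ys)
  have "R x p \<otimes> (R y q \<otimes> row q ys) = R y q \<otimes> (R x p \<otimes> row q ys)"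
    using Cons.prems by (intro mult_left_commute R_commute R_closed row_closed) auto
  also have "\<dots> = R y q \<otimes> (row q ys \<otimes> R x p)"
    using Cons by auto
  finally show ?case
    using Cons.prems by (auto simp: m_assoc R_closed row_closed)
qed

lemma row_row_commute:
  assumes "p \<in> I" "q \<in> I" "p \<noteq> q" "set xs \<subseteq> I" "set ys \<subseteq> I"
    and "p \<notin> set xs" "q \<notin> set xs" "p \<notin> set ys" "q \<notin> set ys" "set xs \<inter> set ys = {}"
  shows "row p xs \<otimes> row q ys = row q ys \<otimes> row p xs"
  using assms
proof (induction xs)
  case Nil
  then show ?case by (simp add: row_closed)
next
  case (Cons x xs)
  have "R x p \<otimes> (row q ys \<otimes> row p xs) = row q ys \<otimes> (R x p \<otimes> row p xs)"
    using Cons.prems by (intro mult_left_commute R_row_commute R_closed row_closed) auto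
  then show ?case
    using Cons by (auto simp: m_assoc R_closed row_closed)
qed

text \<open>The factor \<open>R q p\<close> is carried past one pair \<open>R x p\<close>,
  \<open>R x q\<close> at a time, each passage being one use of the Yang--Baxter equation.\<close>

lemma row_yang_baxter:
  assumes "p \<in> I" "q \<in> I" "p \<noteq> q" "set xs \<subseteq> I" "distinct xs" "p \<notin> set xs" "q \<notin> set xs"
  shows "R q p \<otimes> (row p xs \<otimes> row q xs) = row q xs \<otimes> (row p xs \<otimes> R q p)"
  using assms
proof (induction xs)
  case Nil
  then show ?case by (simp add: R_closed)
next
  case (Cons x xs)
  have [simp]: "p \<in> I" "q \<in> I" "x \<in> I" "set xs \<subseteq> I" "p \<noteq> q" "q \<noteq> p" "p \<noteq> x" "q \<noteq> x" "x \<noteq> p" "x \<noteq> q"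
    "p \<notin> set xs" "q \<notin> set xs" "x \<notin> set xs" "distinct xs"
    using Cons.prems by auto
  have [simp]: "R x p \<in> carrier G" "R x q \<in> carrier G" "R q p \<in> carrier G"
    "row p xs \<in> carrier G" "row q xs \<in> carrier G"
    by (simp_all add: R_closed row_closed)
  \<comment> \<open>\<open>R x q\<close> moves left through \<open>row p xs\<close>, since its index
    pair is disjoint from that of every factor there; this forms the triple needed for
    Yang--Baxter.\<close>
  have "R q p \<otimes> (R x p \<otimes> row p xs \<otimes> (R x q \<otimes> row q xs))
      = R q p \<otimes> (R x p \<otimes> (R x q \<otimes> (row p xs \<otimes> row q xs)))"
    using mult_left_commute[OF R_row_commute[symmetric, of q p x xs], of "row q xs"]
    by (simp add: m_assoc)
  also have "\<dots> = (R q p \<otimes> (R x p \<otimes> R x q)) \<otimes> (row p xs \<otimes> row q xs)"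
    by (simp add: m_assoc)
  also have "\<dots> = (R x q \<otimes> (R x p \<otimes> R q p)) \<otimes> (row p xs \<otimes> row q xs)"
    using yang_baxter[of x q p] by simp
  also have "\<dots> = R x q \<otimes> (R x p \<otimes> (R q p \<otimes> (row p xs \<otimes> row q xs)))"
    by (simp add: m_assoc)
  also have "\<dots> = R x q \<otimes> (R x p \<otimes> (row q xs \<otimes> (row p xs \<otimes> R q p)))"
    using Cons.IH by simp
  also have "\<dots> = R x q \<otimes> (row q xs \<otimes> (R x p \<otimes> (row p xs \<otimes> R q p)))"
    using mult_left_commute[OF R_row_commute[of p q x xs], of "row p xs \<otimes> R q p"] by simp
  finally show ?case
    by (simp add: m_assoc)
qed

lemma cyclic_rows_commute:
  assumes I: "p \<in> I" "q \<in> I" "set A \<subseteq> I" "set B \<subseteq> I"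
    and dist: "distinct (p # q # A @ B)"
  shows "row p (A @ q # B) \<otimes> row q (B @ p # A) = row q (B @ p # A) \<otimes> row p (A @ q # B)"
proof -
  have [simp]: "p \<noteq> q" "q \<noteq> p" "p \<notin> set A" "p \<notin> set B" "q \<notin> set A" "q \<notin> set B"
    "distinct A" "distinct B" "set A \<inter> set B = {}" "set B \<inter> set A = {}"
    using dist by auto
  note [simp] = I
  have [simp]: "row p A \<in> carrier G" "row p B \<in> carrier G" "row q A \<in> carrier G"
    "row q B \<in> carrier G" "R p q \<in> carrier G" "R q p \<in> carrier G"
    by (simp_all add: R_closed row_closed)
  have cancel: "R p q \<otimes> (R q p \<otimes> z) = z" "R q p \<otimes> (R p q \<otimes> z) = z" if "z \<in> carrier G" for z
    using that by (simp_all add: R_unitary flip: m_assoc)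
  have rows: "row p (A @ q # B) = row p A \<otimes> (R q p \<otimes> row p B)"
    "row q (B @ p # A) = row q B \<otimes> (R p q \<otimes> row q A)"
    by (simp_all add: row_append)
  have "row p (A @ q # B) \<otimes> row q (B @ p # A)
      = row p A \<otimes> ((R q p \<otimes> (row p B \<otimes> row q B)) \<otimes> (R p q \<otimes> row q A))"
    by (simp add: rows m_assoc)
  \<comment> \<open>Having passed the rows of \<open>B\<close>, \<open>R q p\<close> stands directly
    before \<open>R p q\<close> and cancels.\<close>
  also have "\<dots> = row p A \<otimes> (row q B \<otimes> (row p B \<otimes> row q A))"
    by (simp add: row_yang_baxter m_assoc cancel)
  also have "\<dots> = row p A \<otimes> (row q B \<otimes> (row q A \<otimes> row p B))"
    using row_row_commute[of p q B A] by simp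
  also have "\<dots> = row q B \<otimes> (row p A \<otimes> (row q A \<otimes> row p B))"
    by (intro mult_left_commute row_row_commute) simp_all
  \<comment> \<open>The common word is reached. From here the first half is run backwards with
    \<open>p\<close>, \<open>q\<close> and \<open>A\<close>, \<open>B\<close> exchanged, starting by
    inserting \<open>R p q \<otimes> R q p = \<one>\<close>.\<close>
  also have "\<dots> = row q B \<otimes> ((row p A \<otimes> (row q A \<otimes> R p q)) \<otimes> (R q p \<otimes> row p B))"
    by (simp add: m_assoc cancel)
  also have "\<dots> = row q B \<otimes> ((R p q \<otimes> (row q A \<otimes> row p A)) \<otimes> (R q p \<otimes> row p B))"
    using row_yang_baxter[of q p A] by simp
  also have "\<dots> = row q (B @ p # A) \<otimes> row p (A @ q # B)"
    by (simp add: rows m_assoc)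
  finally show ?thesis .
qed

end

section \<open>Identities for elements \<open>1 + a\<close> in a ring\<close>

context ring
begin

text \<open>Here \<open>b = -a\<close>, and (1 + a)(1 - a) = 1 - a^2 = 1.\<close>

lemma one_plus_nilpotent_unitary:
  assumes "a \<in> carrier R" "b \<in> carrier R" "a \<oplus> b = \<zero>" "a \<otimes> a = \<zero>"
  shows "(\<one> \<oplus> a) \<otimes> (\<one> \<oplus> b) = \<one>"
proof -
  have "b = \<ominus> a"
    using assms by (metis add.inv_equality add.m_comm)
  then show ?thesis
    using assms by (simp add: l_distr r_distr r_minus a_assoc r_neg l_neg)
qed

lemma one_plus_commute:
  assumes "a \<in> carrier R" "b \<in> carrier R" "a \<otimes> b = b \<otimes> a"
  shows "(\<one> \<oplus> a) \<otimes> (\<one> \<oplus> b) = (\<one> \<oplus> b) \<otimes> (\<one> \<oplus> a)"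
  using assms by (simp add: l_distr r_distr a_ac)

text \<open>This reduces commutation of the Dunkl elements to that of the products subtracted from 1
  in them.\<close>

lemma one_minus_commute:
  assumes "a \<in> carrier R" "b \<in> carrier R" "a \<otimes> b = b \<otimes> a"
  shows "(\<one> \<ominus> a) \<otimes> (\<one> \<ominus> b) = (\<one> \<ominus> b) \<otimes> (\<one> \<ominus> a)"
  using one_plus_commute[of "\<ominus> a" "\<ominus> b"] assms by (simp add: minus_eq l_minus r_minus)

text \<open>After expansion the linear terms agree, and \<open>ac\<close> and \<open>ca\<close> turn
  both quadratic parts into ab + ba + bc + cb. The cubic terms abc and cba are equal by a separate
  computation. The intended values are a = [ij], b = [ik], c = [jk].\<close>

lemma one_plus_yang_baxter:
  assumes [simp]: "a \<in> carrier R" "b \<in> carrier R" "c \<in> carrier R"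
    and sq: "a \<otimes> a = \<zero>" "c \<otimes> c = \<zero>"
    and ac: "a \<otimes> c = c \<otimes> b \<oplus> b \<otimes> a" and ca: "c \<otimes> a = a \<otimes> b \<oplus> b \<otimes> c"
  shows "(\<one> \<oplus> a) \<otimes> ((\<one> \<oplus> b) \<otimes> (\<one> \<oplus> c)) = (\<one> \<oplus> c) \<otimes> ((\<one> \<oplus> b) \<otimes> (\<one> \<oplus> a))"
proof -
  \<comment> \<open>As cc = 0, the term bc can be added to ab for free, which makes the bracket
    equal to ca.\<close>
  have "a \<otimes> (b \<otimes> c) = (a \<otimes> b \<oplus> b \<otimes> c) \<otimes> c"
    using sq by (simp add: l_distr m_assoc)
  also have "\<dots> = c \<otimes> (c \<otimes> b \<oplus> b \<otimes> a)"
    by (simp add: m_assoc flip: ac ca)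
  also have "\<dots> = c \<otimes> (b \<otimes> a)"
    using sq by (simp add: r_distr flip: m_assoc)
  finally have cubic: "a \<otimes> (b \<otimes> c) = c \<otimes> (b \<otimes> a)" .
  show ?thesis
    by (simp add: l_distr r_distr cubic ac ca a_ac)
qed

end

section \<open>The defining relations in the Fomin--Kirillov algebra\<close>

context
  fixes n :: nat
begin

interpretation FK: ring "FK_alg n"
  by (rule ring_FK_alg)

lemma FK_quot_hom: "ring_hom_ring (FK_free n) (FK_alg n) (a_r_coset (FK_free n) (FK_ideal n))"
  unfolding FK_alg_def by (rule ideal.rcos_ring_hom_ring[OF ideal_FK_ideal])

lemma FK_rel_coset:
  assumes "r \<in> FK_rels n"
  shows "FK_ideal n +>\<^bsub>FK_free n\<^esub> r = \<zero>\<^bsub>FK_alg n\<^esub>"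
proof -
  interpret ideal "FK_ideal n" "FK_free n" by (rule ideal_FK_ideal)
  have "r \<in> FK_ideal n"
    unfolding FK_ideal_def using assms genideal_self[OF FK_rels_subset] by blast
  then show ?thesis
    by (simp add: a_rcos_const FK_alg_def FactRing_def)
qed

lemma FK_quot_simps:
  assumes "f \<in> carrier (FK_free n)" "g \<in> carrier (FK_free n)"
  shows "FK_ideal n +>\<^bsub>FK_free n\<^esub> (f + g) =
      (FK_ideal n +>\<^bsub>FK_free n\<^esub> f) \<oplus>\<^bsub>FK_alg n\<^esub> (FK_ideal n +>\<^bsub>FK_free n\<^esub> g)"
    and "FK_ideal n +>\<^bsub>FK_free n\<^esub> (f * g) =
      (FK_ideal n +>\<^bsub>FK_free n\<^esub> f) \<otimes>\<^bsub>FK_alg n\<^esub> (FK_ideal n +>\<^bsub>FK_free n\<^esub> g)"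
proof -
  interpret h: ring_hom_ring "FK_free n" "FK_alg n" "a_r_coset (FK_free n) (FK_ideal n)"
    by (rule FK_quot_hom)
  show "FK_ideal n +>\<^bsub>FK_free n\<^esub> (f + g) =
      (FK_ideal n +>\<^bsub>FK_free n\<^esub> f) \<oplus>\<^bsub>FK_alg n\<^esub> (FK_ideal n +>\<^bsub>FK_free n\<^esub> g)"
    and "FK_ideal n +>\<^bsub>FK_free n\<^esub> (f * g) =
      (FK_ideal n +>\<^bsub>FK_free n\<^esub> f) \<otimes>\<^bsub>FK_alg n\<^esub> (FK_ideal n +>\<^bsub>FK_free n\<^esub> g)"
    using h.hom_add[of f g] h.hom_mult[of f g] assms by simp_all
qed

lemma free_gen_FK_closed:
  "\<lbrakk>i \<in> {1..n}; j \<in> {1..n}; i \<noteq> j\<rbrakk> \<Longrightarrow> free_gen (i, j) \<in> carrier (FK_free n)"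
  by (rule free_gen_closed) (simp add: FK_gens_def)

lemma FK_gen_antisym:
  assumes "{i, j} \<subseteq> {1..n}" "distinct [i, j]"
  shows "FK_gen n i j \<oplus>\<^bsub>FK_alg n\<^esub> FK_gen n j i = \<zero>\<^bsub>FK_alg n\<^esub>"
proof -
  have "free_gen (i, j) + free_gen (j, i) \<in> FK_rels n"
    unfolding FK_rels_def using assms by blast
  from FK_rel_coset[OF this] show ?thesis
    using assms by (simp add: FK_gen_def FK_quot_simps free_gen_FK_closed)
qed

lemma FK_gen_square:
  assumes "{i, j} \<subseteq> {1..n}" "distinct [i, j]"
  shows "FK_gen n i j \<otimes>\<^bsub>FK_alg n\<^esub> FK_gen n i j = \<zero>\<^bsub>FK_alg n\<^esub>"
proof -
  have "free_gen (i, j) * free_gen (i, j) \<in> FK_rels n"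
    unfolding FK_rels_def using assms by blast
  from FK_rel_coset[OF this] show ?thesis
    using assms by (simp add: FK_gen_def FK_quot_simps free_gen_FK_closed)
qed

lemma FK_gen_triangle:
  assumes "{i, j, k} \<subseteq> {1..n}" "distinct [i, j, k]"
  shows "FK_gen n i j \<otimes>\<^bsub>FK_alg n\<^esub> FK_gen n j k \<oplus>\<^bsub>FK_alg n\<^esub> FK_gen n j k \<otimes>\<^bsub>FK_alg n\<^esub> FK_gen n k i
    \<oplus>\<^bsub>FK_alg n\<^esub> FK_gen n k i \<otimes>\<^bsub>FK_alg n\<^esub> FK_gen n i j = \<zero>\<^bsub>FK_alg n\<^esub>"
proof -
  have "free_gen (i, j) * free_gen (j, k) + free_gen (j, k) * free_gen (k, i)
      + free_gen (k, i) * free_gen (i, j) \<in> FK_rels n"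
    unfolding FK_rels_def using assms by blast
  from FK_rel_coset[OF this] show ?thesis
    using assms by (simp add: FK_gen_def FK_quot_simps free_gen_FK_closed free_ring_closed)
qed

lemma FK_gen_commute:
  assumes "{i, j, k, l} \<subseteq> {1..n}" "distinct [i, j, k, l]"
  shows "FK_gen n i j \<otimes>\<^bsub>FK_alg n\<^esub> FK_gen n k l = FK_gen n k l \<otimes>\<^bsub>FK_alg n\<^esub> FK_gen n i j"
proof -
  let ?a = "free_gen (i, j)" and ?b = "free_gen (k, l)"
  have closed: "?a \<in> carrier (FK_free n)" "?b \<in> carrier (FK_free n)"
    using assms by (simp_all add: free_gen_FK_closed)
  have gens: "FK_gen n i j \<in> carrier (FK_alg n)" "FK_gen n k l \<in> carrier (FK_alg n)"
    using assms by (simp_all add: FK_gen_closed)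
  have "?a * ?b - ?b * ?a \<in> FK_rels n"
    unfolding FK_rels_def using assms by blast
  note zero = FK_rel_coset[OF this]
  \<comment> \<open>\<open>FK_quot_simps\<close> covers sums and products only, so the relation is
    split off as a summand instead of taking the coset of a difference.\<close>
  have "FK_gen n i j \<otimes>\<^bsub>FK_alg n\<^esub> FK_gen n k l
      = FK_ideal n +>\<^bsub>FK_free n\<^esub> ((?a * ?b - ?b * ?a) + ?b * ?a)"
    using closed by (simp add: FK_gen_def FK_quot_simps)
  also have "\<dots> = \<zero>\<^bsub>FK_alg n\<^esub> \<oplus>\<^bsub>FK_alg n\<^esub> FK_gen n k l \<otimes>\<^bsub>FK_alg n\<^esub> FK_gen n i j"
    unfolding FK_gen_def using closed
    by (simp only: FK_quot_simps zero free_ring_closed)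
  finally show ?thesis
    using gens by simp
qed

lemma FK_gen_swap:
  assumes "{i, j} \<subseteq> {1..n}" "distinct [i, j]"
  shows "FK_gen n j i = \<ominus>\<^bsub>FK_alg n\<^esub> FK_gen n i j"
  using FK_gen_antisym[of j i] assms
  by (intro FK.add.inv_equality[symmetric]) (simp_all add: FK_gen_closed)

text \<open>Replacing [ki] by -[ik] in the three-term relation gives the form of the hypothesis
  \<open>ac\<close> of \<open>one_plus_yang_baxter\<close>.\<close>

lemma FK_gen_triangle_ordered:
  assumes "{i, j, k} \<subseteq> {1..n}" "distinct [i, j, k]"
  shows "FK_gen n i j \<otimes>\<^bsub>FK_alg n\<^esub> FK_gen n j k =
    FK_gen n j k \<otimes>\<^bsub>FK_alg n\<^esub> FK_gen n i k \<oplus>\<^bsub>FK_alg n\<^esub> FK_gen n i k \<otimes>\<^bsub>FK_alg n\<^esub> FK_gen n i j"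
proof -
  have [simp]: "FK_gen n i j \<in> carrier (FK_alg n)" "FK_gen n j k \<in> carrier (FK_alg n)"
    "FK_gen n i k \<in> carrier (FK_alg n)"
    using assms by (simp_all add: FK_gen_closed)
  have ki: "FK_gen n k i = \<ominus>\<^bsub>FK_alg n\<^esub> FK_gen n i k"
    using assms by (intro FK_gen_swap) auto
  let ?u = "FK_gen n j k \<otimes>\<^bsub>FK_alg n\<^esub> FK_gen n i k" and ?v = "FK_gen n i k \<otimes>\<^bsub>FK_alg n\<^esub> FK_gen n i j"
  have "\<ominus>\<^bsub>FK_alg n\<^esub> (\<ominus>\<^bsub>FK_alg n\<^esub> ?u \<oplus>\<^bsub>FK_alg n\<^esub> \<ominus>\<^bsub>FK_alg n\<^esub> ?v) = FK_gen n i j \<otimes>\<^bsub>FK_alg n\<^esub> FK_gen n j k"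
    using FK_gen_triangle[OF assms]
    by (intro FK.minus_equality) (simp_all add: ki FK.l_minus FK.r_minus FK.a_assoc)
  then show ?thesis
    by (simp add: FK.minus_add)
qed

text \<open>Unitarity comes from antisymmetry and nilpotency, commutation from the relation for
  disjoint pairs, and Yang--Baxter from the three-term relation together with nilpotency and
  antisymmetry.\<close>

lemma FK_yang_baxter_family:
  "yang_baxter_family (FK_alg n) {1..n} (\<lambda>i j. \<one>\<^bsub>FK_alg n\<^esub> \<oplus>\<^bsub>FK_alg n\<^esub> FK_gen n i j)"
proof (unfold_locales, goal_cases)
  case (1 i j)
  then show ?case by (simp add: FK_gen_closed)
next
  case (2 i j)
  then show ?case
    by (intro FK.one_plus_nilpotent_unitary FK_gen_antisym FK_gen_square FK_gen_closed) auto
next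
  case (3 i j k l)
  then show ?case
    by (intro FK.one_plus_commute FK_gen_commute FK_gen_closed) auto
next
  case (4 i j k)
  have closed [simp]: "FK_gen n i j \<in> carrier (FK_alg n)" "FK_gen n j k \<in> carrier (FK_alg n)"
    "FK_gen n i k \<in> carrier (FK_alg n)"
    using 4 by (simp_all add: FK_gen_closed)
  have swap: "FK_gen n j i = \<ominus>\<^bsub>FK_alg n\<^esub> FK_gen n i j" "FK_gen n k j = \<ominus>\<^bsub>FK_alg n\<^esub> FK_gen n j k"
    "FK_gen n k i = \<ominus>\<^bsub>FK_alg n\<^esub> FK_gen n i k"
    using 4 by (auto intro!: FK_gen_swap)
  \<comment> \<open>The hypothesis \<open>ca\<close> is the three-term relation for the reversed
    triple k, j, i: reversing all index pairs changes two signs in each product, and these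
    cancel.\<close>
  have "FK_gen n k j \<otimes>\<^bsub>FK_alg n\<^esub> FK_gen n j i =
    FK_gen n j i \<otimes>\<^bsub>FK_alg n\<^esub> FK_gen n k i \<oplus>\<^bsub>FK_alg n\<^esub> FK_gen n k i \<otimes>\<^bsub>FK_alg n\<^esub> FK_gen n k j"
    using 4 by (intro FK_gen_triangle_ordered) auto
  then have "FK_gen n j k \<otimes>\<^bsub>FK_alg n\<^esub> FK_gen n i j =
    FK_gen n i j \<otimes>\<^bsub>FK_alg n\<^esub> FK_gen n i k \<oplus>\<^bsub>FK_alg n\<^esub> FK_gen n i k \<otimes>\<^bsub>FK_alg n\<^esub> FK_gen n j k"
    by (simp add: swap FK.l_minus FK.r_minus)
  then show ?case
    using 4 by (intro FK.one_plus_yang_baxter FK_gen_square FK_gen_triangle_ordered closed) auto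
qed

section \<open>Commutation of the Dunkl elements\<close>

interpretation yang_baxter_family "FK_alg n" "{1..n}"
  "\<lambda>i j. \<one>\<^bsub>FK_alg n\<^esub> \<oplus>\<^bsub>FK_alg n\<^esub> FK_gen n i j"
  by (rule FK_yang_baxter_family)

lemma dunkl_K_commute_less:
  assumes "1 \<le> p" "p < q" "q \<le> n"
  shows "dunkl_K n p \<otimes>\<^bsub>FK_alg n\<^esub> dunkl_K n q = dunkl_K n q \<otimes>\<^bsub>FK_alg n\<^esub> dunkl_K n p"
proof -
  \<comment> \<open>\<open>A\<close> runs p-1, ..., 1, n, ..., q+1 and \<open>B\<close> runs q-1,
    ..., p+1.\<close>
  define A where "A = rev [1..<p] @ rev [Suc q..<Suc n]"
  define B where "B = rev [Suc p..<q]"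
  \<comment> \<open>For \<open>p\<close> the run from n down to p+1 is cut at \<open>q\<close>; for
    \<open>q\<close> the run from q-1 down to 1 is cut at \<open>p\<close>.\<close>
  have split: "[i..<k] = [i..<j] @ j # [Suc j..<k]" if "i \<le> j" "j < k" for i j k :: nat
    using that by (metis le_less_trans less_imp_le upt_add_eq_append upt_conv_Cons le_add_diff_inverse)
  have p: "dunkl_K n p = \<one>\<^bsub>FK_alg n\<^esub> \<ominus>\<^bsub>FK_alg n\<^esub> row p (A @ q # B)"
    using split[of "Suc p" q "Suc n"] assms by (simp add: dunkl_K_def row_def A_def B_def del: upt_Suc)
  have q: "dunkl_K n q = \<one>\<^bsub>FK_alg n\<^esub> \<ominus>\<^bsub>FK_alg n\<^esub> row q (B @ p # A)"
    using split[of 1 p q] assms by (simp add: dunkl_K_def row_def A_def B_def del: upt_Suc)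
  have indices: "set A \<subseteq> {1..n}" "set B \<subseteq> {1..n}" "distinct (p # q # A @ B)"
    using assms by (auto simp: A_def B_def simp del: upt_Suc)
  show ?thesis
    unfolding p q using assms indices
    by (intro FK.one_minus_commute cyclic_rows_commute row_closed) auto
qed

end

theorem theorem2p2:
  fixes n p q :: nat
  assumes "n \<ge> 1" and "p \<in> {1..n}" and "q \<in> {1..n}"
  shows "dunkl_K n p \<otimes>\<^bsub>FK_alg n\<^esub> dunkl_K n q = dunkl_K n q \<otimes>\<^bsub>FK_alg n\<^esub> dunkl_K n p"
  using assms dunkl_K_commute_less[of p q n] dunkl_K_commute_less[of q p n]
  by (cases p q rule: linorder_cases) auto

end
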